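(* Let $M^3$ be a three-dimensional Riemannian manifold and let $\gamma: I\to M^{3}$ be a regular curve with curvature $\kappa>0$ and torsion $\tau$. Then $\gamma$ makes a constant angle with a parallel transported field $V$ (that is, there is a unit vector field $V$ along $\gamma$ with $\nabla_{\gamma'}V=0$ such that the angle between the unit tangent $T$ and $V$ is constant) if, and only if, the ratio $\tau/\kappa$ is constant. In addition, $\tau/\kappa=\cot(\theta)$ and $V=\cos(\theta)\,T+\sin(\theta)\,B$, where $\theta$ is a real constant with $\langle T,V\rangle=\cos\theta$ and $\{T,N,B\}$ is the Frenet frame of $\gamma$.
   Context: $\nabla$ is the Levi-Civita connection of $M^3$ and $I$ is an interval. The (positively oriented orthonormal) Frenet frame $\{T,N,B\}$ of a curve with $\kappa>0$, with curvature $\kappa$ and torsion $\tau$, satisfies, with respect to arc length, $\nabla_TT=\kappa N$, $\nabla_TN=-\kappa T+\tau B$, $\nabla_TB=-\tau N$. *)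

theory Defs
  imports "HOL-Analysis.Analysis"
begin

text \<open>
  \<open>Ck_on k S f\<close> is used only for sets \<open>S\<close> that are open, or relatively open in a nondegenerate
  interval of the real line. On such sets the derivative within \<open>S\<close> is unique; at an endpoint of
  an interval it is the one-sided derivative.
\<close>

primrec Ck_on :: "nat \<Rightarrow> 'a::euclidean_space set \<Rightarrow> ('a \<Rightarrow> 'b::euclidean_space) \<Rightarrow> bool" where
  "Ck_on 0 S f \<longleftrightarrow> continuous_on S f"
| "Ck_on (Suc k) S f \<longleftrightarrow> f differentiable_on S \<and>
     (\<forall>v. Ck_on k S (\<lambda>x. frechet_derivative f (at x within S) v))"

definition smooth_on :: "'a::euclidean_space set \<Rightarrow> ('a \<Rightarrow> 'b::euclidean_space) \<Rightarrow> bool" where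
  "smooth_on S f \<longleftrightarrow> (\<forall>k. Ck_on k S f)"

text \<open>A chart is a pair of its domain and its coordinate map.\<close>

type_synonym ('p, 'n) chart = "'p set \<times> ('p \<Rightarrow> real ^ 'n)"

definition chart_image :: "('p, 'n::finite) chart \<Rightarrow> (real ^ 'n) set" where
  "chart_image c = snd c ` fst c"

definition transition :: "('p, 'n::finite) chart \<Rightarrow> ('p, 'n) chart \<Rightarrow> real ^ 'n \<Rightarrow> real ^ 'n" where
  "transition c d = snd d \<circ> inv_into (fst c) (snd c)"

definition jacobian ::
  "('p, 'n::finite) chart \<Rightarrow> ('p, 'n) chart \<Rightarrow> real ^ 'n \<Rightarrow> real ^ 'n \<Rightarrow> real ^ 'n" where
  "jacobian c d x = frechet_derivative (transition c d) (at x)"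

definition hessian ::
  "('p, 'n::finite) chart \<Rightarrow> ('p, 'n) chart \<Rightarrow> real ^ 'n \<Rightarrow> real ^ 'n \<Rightarrow> real ^ 'n \<Rightarrow> real ^ 'n" where
  "hessian c d x u v = frechet_derivative (\<lambda>y. jacobian c d y v) (at x) u"

definition smooth_manifold :: "'p topology \<Rightarrow> ('p, 'n::finite) chart set \<Rightarrow> bool" where
  "smooth_manifold X A \<longleftrightarrow>
     Hausdorff_space X \<and> second_countable X \<and>
     \<Union>(fst ` A) = topspace X \<and>
     (\<forall>c\<in>A. openin X (fst c) \<and> open (chart_image c) \<and>
        homeomorphic_map (subtopology X (fst c)) (top_of_set (chart_image c)) (snd c)) \<and>
     (\<forall>c\<in>A. \<forall>d\<in>A. smooth_on (snd c ` (fst c \<inter> fst d)) (transition c d))"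

definition charts_at :: "('p, 'n::finite) chart set \<Rightarrow> 'p \<Rightarrow> ('p, 'n) chart set" where
  "charts_at A p = {c \<in> A. p \<in> fst c}"

text \<open>
  A tangent vector at \<open>p\<close> is given by its components in all charts around \<open>p\<close>, which are related by
  the Jacobians of the transition maps. Setting the components to zero in all other charts makes
  this representation unique, so that equality of tangent vectors is equality of functions.
\<close>

type_synonym ('p, 'n) tvec = "('p, 'n) chart \<Rightarrow> real ^ 'n"

definition tangent_space :: "('p, 'n::finite) chart set \<Rightarrow> 'p \<Rightarrow> ('p, 'n) tvec set" where
  "tangent_space A p = {v.
     (\<forall>c\<in>charts_at A p. \<forall>d\<in>charts_at A p. v d = jacobian c d (snd c p) (v c)) \<and>
     (\<forall>c. c \<notin> charts_at A p \<longrightarrow> v c = 0)}"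

definition tv_zero :: "('p, 'n::finite) tvec" where
  "tv_zero = (\<lambda>c. 0)"

definition tv_scale :: "real \<Rightarrow> ('p, 'n::finite) tvec \<Rightarrow> ('p, 'n) tvec" where
  "tv_scale a v = (\<lambda>c. a *\<^sub>R v c)"

definition tv_add :: "('p, 'n::finite) tvec \<Rightarrow> ('p, 'n) tvec \<Rightarrow> ('p, 'n) tvec" where
  "tv_add u v = (\<lambda>c. u c + v c)"

text \<open>The tangent vector at \<open>p\<close> whose components in the chart \<open>c\<close> are \<open>u\<close>.\<close>

definition chart_tvec ::
  "('p, 'n::finite) chart set \<Rightarrow> ('p, 'n) chart \<Rightarrow> 'p \<Rightarrow> real ^ 'n \<Rightarrow> ('p, 'n) tvec" where
  "chart_tvec A c p u = (\<lambda>d. if d \<in> charts_at A p then jacobian c d (snd c p) u else 0)"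

type_synonym ('p, 'n) metric = "'p \<Rightarrow> ('p, 'n) tvec \<Rightarrow> ('p, 'n) tvec \<Rightarrow> real"

text \<open>The metric in the chart \<open>c\<close>, as a bilinear form depending on the coordinates \<open>x\<close>.\<close>

definition metric_in_chart ::
  "('p, 'n::finite) chart set \<Rightarrow> ('p, 'n) metric \<Rightarrow> ('p, 'n) chart \<Rightarrow>
     real ^ 'n \<Rightarrow> real ^ 'n \<Rightarrow> real ^ 'n \<Rightarrow> real" where
  "metric_in_chart A g c x u v =
     (let p = inv_into (fst c) (snd c) x in g p (chart_tvec A c p u) (chart_tvec A c p v))"

definition riemannian_metric ::
  "'p topology \<Rightarrow> ('p, 'n::finite) chart set \<Rightarrow> ('p, 'n) metric \<Rightarrow> bool" where
  "riemannian_metric X A g \<longleftrightarrow>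
     (\<forall>p\<in>topspace X.
        (\<forall>u\<in>tangent_space A p. \<forall>v\<in>tangent_space A p. g p u v = g p v u) \<and>
        (\<forall>u\<in>tangent_space A p. \<forall>v\<in>tangent_space A p. \<forall>w\<in>tangent_space A p.
           g p (tv_add u v) w = g p u w + g p v w) \<and>
        (\<forall>u\<in>tangent_space A p. \<forall>v\<in>tangent_space A p. \<forall>a. g p (tv_scale a u) v = a * g p u v) \<and>
        (\<forall>u\<in>tangent_space A p. u \<noteq> tv_zero \<longrightarrow> g p u u > 0)) \<and>
     (\<forall>c\<in>A. \<forall>u v. smooth_on (chart_image c) (\<lambda>x. metric_in_chart A g c x u v))"

definition tv_norm :: "('p, 'n::finite) metric \<Rightarrow> 'p \<Rightarrow> ('p, 'n) tvec \<Rightarrow> real" where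
  "tv_norm g p v = sqrt (g p v v)"

definition tv_angle ::
  "('p, 'n::finite) metric \<Rightarrow> 'p \<Rightarrow> ('p, 'n) tvec \<Rightarrow> ('p, 'n) tvec \<Rightarrow> real" where
  "tv_angle g p u v = arccos (g p u v / (tv_norm g p u * tv_norm g p v))"

text \<open>
  An affine connection is given by its coefficients in the charts: in the notation with indices,
  \<open>\<Gamma> c x u v\<close> is the vector with components $\Gamma^k_{ij}(x)\, u^i v^j$, that is, the components
  of $\nabla_u v$ for vector fields \<open>u\<close> and \<open>v\<close> with constant components in the chart \<open>c\<close>. The
  transformation law is the one that makes $\nabla_u v = D v(u) + \Gamma(u, v)$
  independent of the chart.
\<close>

type_synonym ('p, 'n) connection =
  "('p, 'n) chart \<Rightarrow> real ^ 'n \<Rightarrow> real ^ 'n \<Rightarrow> real ^ 'n \<Rightarrow> real ^ 'n"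

definition affine_connection ::
  "('p, 'n::finite) chart set \<Rightarrow> ('p, 'n) connection \<Rightarrow> bool" where
  "affine_connection A \<Gamma> \<longleftrightarrow>
     (\<forall>c\<in>A. (\<forall>x\<in>chart_image c. bilinear (\<Gamma> c x)) \<and>
        (\<forall>u v. smooth_on (chart_image c) (\<lambda>x. \<Gamma> c x u v))) \<and>
     (\<forall>c\<in>A. \<forall>d\<in>A. \<forall>p\<in>fst c \<inter> fst d. \<forall>u v.
        jacobian c d (snd c p) (\<Gamma> c (snd c p) u v) =
          hessian c d (snd c p) u v +
          \<Gamma> d (snd d p) (jacobian c d (snd c p) u) (jacobian c d (snd c p) v))"

text \<open>
  Torsion-freeness and compatibility with the metric,
  $w\langle u, v\rangle = \langle\nabla_w u, v\rangle + \langle u, \nabla_w v\rangle$,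
  are expressed on fields with constant components in a chart; these commute.
\<close>

definition levi_civita_connection ::
  "('p, 'n::finite) chart set \<Rightarrow> ('p, 'n) metric \<Rightarrow> ('p, 'n) connection \<Rightarrow> bool" where
  "levi_civita_connection A g \<Gamma> \<longleftrightarrow>
     affine_connection A \<Gamma> \<and>
     (\<forall>c\<in>A. \<forall>x\<in>chart_image c. \<forall>u v. \<Gamma> c x u v = \<Gamma> c x v u) \<and>
     (\<forall>c\<in>A. \<forall>x\<in>chart_image c. \<forall>u v w.
        frechet_derivative (\<lambda>y. metric_in_chart A g c y u v) (at x) w =
          metric_in_chart A g c x (\<Gamma> c x w u) v + metric_in_chart A g c x u (\<Gamma> c x w v))"

definition velocity ::
  "('p, 'n::finite) chart set \<Rightarrow> real set \<Rightarrow> (real \<Rightarrow> 'p) \<Rightarrow> real \<Rightarrow> ('p, 'n) tvec" where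
  "velocity A I \<gamma> t = (\<lambda>c. if c \<in> charts_at A (\<gamma> t)
     then vector_derivative (\<lambda>s. snd c (\<gamma> s)) (at t within I) else 0)"

definition regular_curve ::
  "'p topology \<Rightarrow> ('p, 'n::finite) chart set \<Rightarrow> real set \<Rightarrow> (real \<Rightarrow> 'p) \<Rightarrow> bool" where
  "regular_curve X A I \<gamma> \<longleftrightarrow>
     continuous_map (top_of_set I) X \<gamma> \<and>
     (\<forall>c\<in>A. smooth_on {t \<in> I. \<gamma> t \<in> fst c} (\<lambda>t. snd c (\<gamma> t))) \<and>
     (\<forall>t\<in>I. velocity A I \<gamma> t \<noteq> tv_zero)"

definition smooth_field_along ::
  "('p, 'n::finite) chart set \<Rightarrow> real set \<Rightarrow> (real \<Rightarrow> 'p) \<Rightarrow> (real \<Rightarrow> ('p, 'n) tvec) \<Rightarrow> bool" where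
  "smooth_field_along A I \<gamma> V \<longleftrightarrow>
     (\<forall>t\<in>I. V t \<in> tangent_space A (\<gamma> t)) \<and>
     (\<forall>c\<in>A. smooth_on {t \<in> I. \<gamma> t \<in> fst c} (\<lambda>t. V t c))"

definition cov_deriv ::
  "('p, 'n::finite) chart set \<Rightarrow> ('p, 'n) connection \<Rightarrow> real set \<Rightarrow> (real \<Rightarrow> 'p) \<Rightarrow>
     (real \<Rightarrow> ('p, 'n) tvec) \<Rightarrow> real \<Rightarrow> ('p, 'n) tvec" where
  "cov_deriv A \<Gamma> I \<gamma> V t = (\<lambda>c. if c \<in> charts_at A (\<gamma> t)
     then vector_derivative (\<lambda>s. V s c) (at t within I)
          + \<Gamma> c (snd c (\<gamma> t)) (velocity A I \<gamma> t c) (V t c)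
     else 0)"

definition parallel_along ::
  "('p, 'n::finite) chart set \<Rightarrow> ('p, 'n) connection \<Rightarrow> real set \<Rightarrow> (real \<Rightarrow> 'p) \<Rightarrow>
     (real \<Rightarrow> ('p, 'n) tvec) \<Rightarrow> bool" where
  "parallel_along A \<Gamma> I \<gamma> V \<longleftrightarrow>
     smooth_field_along A I \<gamma> V \<and> (\<forall>t\<in>I. cov_deriv A \<Gamma> I \<gamma> V t = tv_zero)"

definition unit_tangent ::
  "('p, 'n::finite) chart set \<Rightarrow> ('p, 'n) metric \<Rightarrow> real set \<Rightarrow> (real \<Rightarrow> 'p) \<Rightarrow>
     real \<Rightarrow> ('p, 'n) tvec" where
  "unit_tangent A g I \<gamma> t =
     tv_scale (1 / tv_norm g (\<gamma> t) (velocity A I \<gamma> t)) (velocity A I \<gamma> t)"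

text \<open>
  The covariant derivative $\nabla_T V$ with respect to arc length; the curve itself need not be
  parametrised by arc length.
\<close>

definition cov_deriv_arclength ::
  "('p, 'n::finite) chart set \<Rightarrow> ('p, 'n) metric \<Rightarrow> ('p, 'n) connection \<Rightarrow> real set \<Rightarrow>
     (real \<Rightarrow> 'p) \<Rightarrow> (real \<Rightarrow> ('p, 'n) tvec) \<Rightarrow> real \<Rightarrow> ('p, 'n) tvec" where
  "cov_deriv_arclength A g \<Gamma> I \<gamma> V t =
     tv_scale (1 / tv_norm g (\<gamma> t) (velocity A I \<gamma> t)) (cov_deriv A \<Gamma> I \<gamma> V t)"

definition curvature ::
  "('p, 'n::finite) chart set \<Rightarrow> ('p, 'n) metric \<Rightarrow> ('p, 'n) connection \<Rightarrow> real set \<Rightarrow>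
     (real \<Rightarrow> 'p) \<Rightarrow> real \<Rightarrow> real" where
  "curvature A g \<Gamma> I \<gamma> t =
     tv_norm g (\<gamma> t) (cov_deriv_arclength A g \<Gamma> I \<gamma> (unit_tangent A g I \<gamma>) t)"

text \<open>
  An orientation of the tangent spaces along \<open>\<gamma>\<close>: \<open>\<omega> c t\<close> is \<open>1\<close> or \<open>-1\<close> according to whether the
  coordinate basis of the chart \<open>c\<close> at \<open>\<gamma> t\<close> is positively oriented or not. Any orientation of the
  manifold restricts to one, but one exists along \<open>\<gamma>\<close> even if the manifold is not orientable.
\<close>

definition orientation_along ::
  "('p, 'n::finite) chart set \<Rightarrow> real set \<Rightarrow> (real \<Rightarrow> 'p) \<Rightarrow>
     (('p, 'n) chart \<Rightarrow> real \<Rightarrow> real) \<Rightarrow> bool" where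
  "orientation_along A I \<gamma> \<omega> \<longleftrightarrow>
     (\<forall>c\<in>A. (\<forall>t\<in>I. \<gamma> t \<in> fst c \<longrightarrow> \<omega> c t \<in> {-1, 1}) \<and>
        continuous_on {t \<in> I. \<gamma> t \<in> fst c} (\<omega> c)) \<and>
     (\<forall>t\<in>I. \<forall>c\<in>charts_at A (\<gamma> t). \<forall>d\<in>charts_at A (\<gamma> t).
        \<omega> d t = sgn (det (matrix (jacobian c d (snd c (\<gamma> t))))) * \<omega> c t)"

text \<open>
  Only the first Frenet equation is part of the definition; the equations for \<open>N\<close> and \<open>B\<close> follow
  from orthonormality, with the torsion defined below as the \<open>B\<close>-component of $\nabla_T N$. The
  positivity condition does not depend on the chart.
\<close>

definition frenet_frame ::
  "('p, 3) chart set \<Rightarrow> ('p, 3) metric \<Rightarrow> ('p, 3) connection \<Rightarrow> real set \<Rightarrow> (real \<Rightarrow> 'p) \<Rightarrow>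
     (('p, 3) chart \<Rightarrow> real \<Rightarrow> real) \<Rightarrow>
     (real \<Rightarrow> ('p, 3) tvec) \<Rightarrow> (real \<Rightarrow> ('p, 3) tvec) \<Rightarrow> (real \<Rightarrow> ('p, 3) tvec) \<Rightarrow> bool" where
  "frenet_frame A g \<Gamma> I \<gamma> \<omega> T N B \<longleftrightarrow>
     smooth_field_along A I \<gamma> T \<and> smooth_field_along A I \<gamma> N \<and> smooth_field_along A I \<gamma> B \<and>
     (\<forall>t\<in>I.
        T t = unit_tangent A g I \<gamma> t \<and>
        cov_deriv_arclength A g \<Gamma> I \<gamma> T t = tv_scale (curvature A g \<Gamma> I \<gamma> t) (N t) \<and>
        g (\<gamma> t) (N t) (N t) = 1 \<and> g (\<gamma> t) (B t) (B t) = 1 \<and>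
        g (\<gamma> t) (T t) (N t) = 0 \<and> g (\<gamma> t) (T t) (B t) = 0 \<and> g (\<gamma> t) (N t) (B t) = 0 \<and>
        (\<forall>c\<in>charts_at A (\<gamma> t). \<omega> c t * det (vector [T t c, N t c, B t c] :: real ^ 3 ^ 3) > 0))"

definition torsion ::
  "('p, 'n::finite) chart set \<Rightarrow> ('p, 'n) metric \<Rightarrow> ('p, 'n) connection \<Rightarrow> real set \<Rightarrow>
     (real \<Rightarrow> 'p) \<Rightarrow> (real \<Rightarrow> ('p, 'n) tvec) \<Rightarrow> (real \<Rightarrow> ('p, 'n) tvec) \<Rightarrow> real \<Rightarrow> real" where
  "torsion A g \<Gamma> I \<gamma> N B t = g (\<gamma> t) (cov_deriv_arclength A g \<Gamma> I \<gamma> N t) (B t)"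

definition constant_angle_field ::
  "('p, 'n::finite) chart set \<Rightarrow> ('p, 'n) metric \<Rightarrow> ('p, 'n) connection \<Rightarrow> real set \<Rightarrow>
     (real \<Rightarrow> 'p) \<Rightarrow> (real \<Rightarrow> ('p, 'n) tvec) \<Rightarrow> bool" where
  "constant_angle_field A g \<Gamma> I \<gamma> V \<longleftrightarrow>
     parallel_along A \<Gamma> I \<gamma> V \<and>
     (\<forall>t\<in>I. tv_norm g (\<gamma> t) (V t) = 1) \<and>
     (\<exists>\<alpha>. \<forall>t\<in>I. tv_angle g (\<gamma> t) (unit_tangent A g I \<gamma> t) (V t) = \<alpha>)"

end

theory Submission
  imports Defs
begin

text \<open>
  Pairing fields along the curve with a parallel unit field \<open>V\<close>, the product rule for the metric and
  the Frenet equations give $\langle T, V\rangle' = \kappa\langle N, V\rangle$,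
  $\langle N, V\rangle' = -\kappa\langle T, V\rangle + \tau\langle B, V\rangle$ and
  $\langle B, V\rangle' = -\tau\langle N, V\rangle$. If $\langle T, V\rangle$ is constant, then
  $\langle N, V\rangle = 0$, so $\langle B, V\rangle$ is constant as well, and the second equation
  gives $\kappa\cos\theta = \tau\sin\theta$. Conversely, if \<open>\<tau> / \<kappa>\<close> is constant, then
  $\nabla_T(aT + bB) = (a\kappa - b\tau)N$ vanishes for constants $a, b$ with $a / b = \tau/\kappa$.

  All fields along the curve are handled through their components in charts. The transformation law
  of the connection makes the covariant derivative of a field a field of tangent vectors again.
\<close>

section \<open>Differential calculus within subsets of the real line\<close>

text \<open>In finite dimension, linear maps are finite sums over a basis, so it suffices to know
  the derivative of \<open>F s u\<close> for each fixed \<open>u\<close>. This is the product rule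
  applied later to Jacobians and metric coefficients along a curve.\<close>

lemma has_vector_derivative_linear_family:
  fixes F :: "real \<Rightarrow> 'a::euclidean_space \<Rightarrow> 'b::real_normed_vector"
  assumes t: "t \<in> S"
    and lin: "\<And>s. s \<in> S \<Longrightarrow> linear (F s)" and D: "linear D"
    and F: "\<And>u. ((\<lambda>s. F s u) has_vector_derivative D u) (at t within S)"
    and v: "(v has_vector_derivative v') (at t within S)"
  shows "((\<lambda>s. F s (v s)) has_vector_derivative D (v t) + F t v') (at t within S)"
proof -
  have expand: "L u = (\<Sum>b\<in>Basis. (u \<bullet> b) *\<^sub>R L b)" if "linear L"
    for L :: "'a \<Rightarrow> 'b" and u
    using linear_sum[OF that, of "\<lambda>b. (u \<bullet> b) *\<^sub>R b" Basis]
    by (simp add: euclidean_representation linear_cmul[OF that])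
  have "((\<lambda>s. \<Sum>b\<in>Basis. (v s \<bullet> b) *\<^sub>R F s b) has_vector_derivative
      (\<Sum>b\<in>Basis. (v t \<bullet> b) *\<^sub>R D b + (v' \<bullet> b) *\<^sub>R F t b)) (at t within S)"
  proof (rule has_vector_derivative_sum)
    fix b :: 'a
    have "((\<lambda>s. v s \<bullet> b) has_real_derivative v' \<bullet> b) (at t within S)"
      using bounded_linear.has_vector_derivative[OF bounded_linear_inner_left v]
      by (simp add: has_real_derivative_iff_has_vector_derivative)
    from has_vector_derivative_scaleR[OF this F]
    show "((\<lambda>s. (v s \<bullet> b) *\<^sub>R F s b) has_vector_derivative
        (v t \<bullet> b) *\<^sub>R D b + (v' \<bullet> b) *\<^sub>R F t b) (at t within S)" .
  qed
  then show ?thesis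
    unfolding sum.distrib expand[OF D, symmetric] expand[OF lin[OF t], symmetric]
    by (rule has_vector_derivative_transform[OF t, rotated]) (rule expand[OF lin])
qed

text \<open>At a point of \<open>S\<close>, derivatives within \<open>S\<close> depend only on
  values on \<open>S\<close>. Both functions thus have the same set of derivatives there, and the
  choice made by \<open>frechet_derivative\<close> is the same.\<close>

lemma Ck_on_cong:
  assumes "\<And>x. x \<in> S \<Longrightarrow> f x = h x"
  shows "Ck_on k S f = Ck_on k S h"
  using assms
proof (induction k arbitrary: f h)
  case 0
  then show ?case by (auto cong: continuous_on_cong)
next
  case (Suc k)
  have D: "(f has_derivative D) (at x within S) = (h has_derivative D) (at x within S)"
    if "x \<in> S" for x D
    using Suc.prems that has_derivative_transform[of x S f h] has_derivative_transform[of x S h f]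
    by metis
  then have "frechet_derivative f (at x within S) = frechet_derivative h (at x within S)"
    if "x \<in> S" for x
    using that by (simp add: frechet_derivative_def)
  then have "Ck_on k S (\<lambda>x. frechet_derivative f (at x within S) v) =
      Ck_on k S (\<lambda>x. frechet_derivative h (at x within S) v)" for v
    by (intro Suc.IH) simp
  moreover have "(f differentiable_on S) = (h differentiable_on S)"
    unfolding differentiable_on_def differentiable_def using D by blast
  ultimately show ?case by simp
qed

text \<open>A linear map on the reals is determined by its value at 1, which reduces the claim to
  uniqueness of vector derivatives. One-sided derivatives at an endpoint of an interval are
  covered.\<close>

lemma real_has_derivative_unique_within:
  fixes f :: "real \<Rightarrow> 'b::real_normed_vector"
  assumes "at x within S \<noteq> bot"
    and D: "(f has_derivative D) (at x within S)" and E: "(f has_derivative E) (at x within S)"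
  shows "D = E"
proof -
  have "v *\<^sub>R D 1 = D v" "v *\<^sub>R E 1 = E v" for v
    using linear_cmul[OF has_derivative_linear[OF D], of v 1]
      linear_cmul[OF has_derivative_linear[OF E], of v 1] by simp_all
  then have *: "(\<lambda>v. v *\<^sub>R D 1) = D" "(\<lambda>v. v *\<^sub>R E 1) = E"
    by blast+
  have "(f has_vector_derivative D 1) (at x within S)" "(f has_vector_derivative E 1) (at x within S)"
    unfolding has_vector_derivative_def * by (fact D, fact E)
  then have "D 1 = E 1"
    using vector_derivative_unique_within assms(1) by blast
  with * show ?thesis by metis
qed

text \<open>Since \<open>S\<close> has no isolated points, the derivative chosen by
  \<open>frechet_derivative\<close> must be the linear combination of the two derivatives, to which
  the induction hypothesis applies.\<close>

lemma Ck_on_linear_combination: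
  fixes f h :: "real \<Rightarrow> 'b::euclidean_space"
  assumes S: "\<And>x. x \<in> S \<Longrightarrow> at x within S \<noteq> bot"
    and "Ck_on k S f" "Ck_on k S h"
  shows "Ck_on k S (\<lambda>x. a *\<^sub>R f x + b *\<^sub>R h x)"
  using assms(2,3)
proof (induction k arbitrary: f h)
  case 0
  then show ?case by (auto intro!: continuous_intros)
next
  case (Suc k)
  let ?D = "\<lambda>f x. frechet_derivative f (at x within S)"
  let ?q = "\<lambda>x. a *\<^sub>R f x + b *\<^sub>R h x"
  have q: "(?q has_derivative (\<lambda>v. a *\<^sub>R ?D f x v + b *\<^sub>R ?D h x v)) (at x within S)"
    if "x \<in> S" for x
  proof -
    have "f differentiable at x within S" "h differentiable at x within S"
      using Suc.prems that by (auto simp: differentiable_on_def)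
    then show ?thesis
      by (auto simp: frechet_derivative_works intro!: derivative_intros)
  qed
  have "?D ?q x v = a *\<^sub>R ?D f x v + b *\<^sub>R ?D h x v" if x: "x \<in> S" for x v
  proof -
    have "(?q has_derivative ?D ?q x) (at x within S)"
      using q[OF x] frechet_derivative_works differentiable_def by blast
    from real_has_derivative_unique_within[OF S[OF x] this q[OF x]] show ?thesis
      by (simp add: fun_eq_iff)
  qed
  then have "Ck_on k S (\<lambda>x. ?D ?q x v)" for v
    using Ck_on_cong[of S "\<lambda>x. ?D ?q x v"] Suc.IH Suc.prems by simp
  then show ?case
    using q by (auto simp: differentiable_on_def differentiable_def)
qed

lemma smooth_on_differentiable:
  assumes "smooth_on S f" "x \<in> S"
  shows "f differentiable at x within S"
  using spec[OF assms(1)[unfolded smooth_on_def], of "Suc 0"] assms(2)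
  by (simp add: differentiable_on_def)

text \<open>On an open set the derivative within \<open>S\<close>, which \<open>Ck_on\<close> speaks
  of, is the full derivative at all nearby points, so it can be replaced before differentiating
  again.\<close>

lemma smooth_on_open_derivative_differentiable:
  assumes f: "smooth_on S f" and S: "open S" "x \<in> S"
  shows "(\<lambda>y. frechet_derivative f (at y) v) differentiable at x"
proof -
  have "(\<lambda>y. frechet_derivative f (at y within S) v) differentiable (at x within S)"
    using spec[OF f[unfolded smooth_on_def], of "Suc (Suc 0)"] S(2)
    by (simp add: differentiable_on_def)
  then obtain D where "((\<lambda>y. frechet_derivative f (at y within S) v) has_derivative D) (at x)"
    by (auto simp: differentiable_def at_within_open[OF S(2,1)])
  then have "((\<lambda>y. frechet_derivative f (at y) v) has_derivative D) (at x)"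
    by (rule has_derivative_transform_within_open[OF _ S]) (simp add: at_within_open[OF _ S(1)])
  then show ?thesis
    by (auto simp: differentiable_def)
qed

section \<open>Charts and transition maps\<close>

locale riemannian_manifold =
  fixes X :: "'p topology" and A :: "('p, 'n::finite) chart set"
    and g :: "('p, 'n) metric" and \<Gamma> :: "('p, 'n) connection"
  assumes manifold: "smooth_manifold X A"
    and metric: "riemannian_metric X A g"
    and connection: "levi_civita_connection A g \<Gamma>"
begin

lemma charts_atD: "c \<in> charts_at A p \<Longrightarrow> c \<in> A" "c \<in> charts_at A p \<Longrightarrow> p \<in> fst c"
  by (auto simp: charts_at_def)

lemma charts_at_topspace: "c \<in> charts_at A p \<Longrightarrow> p \<in> topspace X"
  using manifold by (auto simp: charts_at_def smooth_manifold_def)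

lemma chart_homeomorphic:
  "c \<in> A \<Longrightarrow> homeomorphic_map (subtopology X (fst c)) (top_of_set (chart_image c)) (snd c)"
  using manifold by (auto simp: smooth_manifold_def)

lemma chart_openin: "c \<in> A \<Longrightarrow> openin X (fst c)"
  using manifold by (auto simp: smooth_manifold_def)

lemma open_chart_image: "c \<in> A \<Longrightarrow> open (chart_image c)"
  using manifold by (auto simp: smooth_manifold_def)

lemma chart_inv_into: "c \<in> A \<Longrightarrow> p \<in> fst c \<Longrightarrow> inv_into (fst c) (snd c) (snd c p) = p"
  using homeomorphic_imp_injective_map[OF chart_homeomorphic] openin_subset[OF chart_openin]
  by (auto simp: Int_absorb1)

text \<open>A chart is an open map onto its image, and the image is open. Openness of the overlap
  turns the derivatives within it into the full derivatives used by \<open>jacobian\<close> and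
  \<open>hessian\<close>.\<close>

lemma open_overlap:
  assumes "c \<in> A" "d \<in> A"
  shows "open (snd c ` (fst c \<inter> fst d))"
proof -
  have "openin (subtopology X (fst c)) (fst c \<inter> fst d)"
    using chart_openin assms by (metis Int_commute openin_subtopology_Int)
  then have "openin (top_of_set (chart_image c)) (snd c ` (fst c \<inter> fst d))"
    using homeomorphic_imp_open_map[OF chart_homeomorphic] assms by (auto simp: open_map_def)
  then show ?thesis
    using open_chart_image[OF assms(1)] by (simp add: openin_open_eq)
qed

lemma transition_apply: "c \<in> A \<Longrightarrow> p \<in> fst c \<Longrightarrow> transition c d (snd c p) = snd d p"
  by (simp add: transition_def chart_inv_into)

lemma transition_smooth:
  "c \<in> A \<Longrightarrow> d \<in> A \<Longrightarrow> smooth_on (snd c ` (fst c \<inter> fst d)) (transition c d)"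
  using manifold by (auto simp: smooth_manifold_def)

lemma transition_has_derivative:
  assumes "c \<in> charts_at A p" "d \<in> charts_at A p"
  shows "(transition c d has_derivative jacobian c d (snd c p)) (at (snd c p))"
proof -
  have x: "snd c p \<in> snd c ` (fst c \<inter> fst d)" and cd: "c \<in> A" "d \<in> A"
    using assms by (auto simp: charts_at_def)
  from smooth_on_differentiable[OF transition_smooth[OF cd] x] show ?thesis
    by (simp add: jacobian_def frechet_derivative_works at_within_open[OF x open_overlap[OF cd]])
qed

lemma linear_jacobian:
  "c \<in> charts_at A p \<Longrightarrow> d \<in> charts_at A p \<Longrightarrow> linear (jacobian c d (snd c p))"
  using transition_has_derivative has_derivative_linear by blast

lemma jacobian_has_derivative:
  assumes "c \<in> charts_at A p" "d \<in> charts_at A p"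
  shows "((\<lambda>y. jacobian c d y v) has_derivative (\<lambda>u. hessian c d (snd c p) u v)) (at (snd c p))"
proof -
  have "snd c p \<in> snd c ` (fst c \<inter> fst d)" and cd: "c \<in> A" "d \<in> A"
    using assms by (auto simp: charts_at_def)
  from smooth_on_open_derivative_differentiable[OF transition_smooth[OF cd] open_overlap[OF cd] this(1)]
  have "(\<lambda>y. jacobian c d y v) differentiable at (snd c p)"
    by (simp add: jacobian_def)
  moreover have "(\<lambda>u. hessian c d (snd c p) u v) =
      frechet_derivative (\<lambda>y. jacobian c d y v) (at (snd c p))"
    by (simp add: hessian_def fun_eq_iff)
  ultimately show ?thesis
    by (simp add: frechet_derivative_works)
qed

lemma jacobian_chain:
  assumes "c \<in> charts_at A p" "d \<in> charts_at A p" "e \<in> charts_at A p"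
  shows "jacobian d e (snd d p) (jacobian c d (snd c p) u) = jacobian c e (snd c p) u"
proof -
  have cd: "c \<in> A" "d \<in> A" "p \<in> fst c" "p \<in> fst d"
    using assms by (auto simp: charts_at_def)
  have "(transition d e \<circ> transition c d has_derivative
      jacobian d e (snd d p) \<circ> jacobian c d (snd c p)) (at (snd c p))"
    using transition_has_derivative[OF assms(1,2)] transition_has_derivative[OF assms(2,3)] cd
    by (intro diff_chain_at) (simp_all add: transition_apply)
  then have "(transition c e has_derivative
      jacobian d e (snd d p) \<circ> jacobian c d (snd c p)) (at (snd c p))"
    \<comment> \<open>The two maps agree on the whole overlap of \<open>c\<close> and
      \<open>d\<close>: \<open>transition_apply\<close> does not ask the point to lie in the domain
      of the target chart.\<close>
    by (rule has_derivative_transform_within_open[OF _ open_overlap[OF cd(1,2)]])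
      (use cd in \<open>auto simp: transition_apply\<close>)
  from has_derivative_unique[OF this transition_has_derivative[OF assms(1,3)]]
  show ?thesis by (simp add: fun_eq_iff)
qed

section \<open>Tangent vectors and their components\<close>

lemma tangent_spaceI:
  assumes "\<And>c d. c \<in> charts_at A p \<Longrightarrow> d \<in> charts_at A p \<Longrightarrow>
      jacobian c d (snd c p) (v c) = v d"
    and "\<And>c. c \<notin> charts_at A p \<Longrightarrow> v c = 0"
  shows "v \<in> tangent_space A p"
  using assms by (simp add: tangent_space_def)

lemma tangent_space_jacobian:
  "v \<in> tangent_space A p \<Longrightarrow> c \<in> charts_at A p \<Longrightarrow> d \<in> charts_at A p \<Longrightarrow>
    jacobian c d (snd c p) (v c) = v d"
  unfolding tangent_space_def mem_Collect_eq by metis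

lemma tangent_space_outside: "v \<in> tangent_space A p \<Longrightarrow> c \<notin> charts_at A p \<Longrightarrow> v c = 0"
  unfolding tangent_space_def by blast

text \<open>Compatibility of the components in different charts is the chain rule
  \<open>jacobian_chain\<close>.\<close>

lemma chart_tvec_in_tangent_space: "c \<in> charts_at A p \<Longrightarrow> chart_tvec A c p u \<in> tangent_space A p"
  by (rule tangent_spaceI) (auto simp: chart_tvec_def jacobian_chain)

text \<open>Makes a tangent vector recoverable from its components in one chart, so that equations
  between tangent vectors and values of the metric can be checked in a single chart.\<close>

lemma chart_tvec_components:
  "c \<in> charts_at A p \<Longrightarrow> v \<in> tangent_space A p \<Longrightarrow> chart_tvec A c p (v c) = v"
  by (rule ext) (simp add: chart_tvec_def tangent_space_jacobian tangent_space_outside)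

lemma chart_tvec_add:
  "c \<in> charts_at A p \<Longrightarrow> chart_tvec A c p (u + v) = tv_add (chart_tvec A c p u) (chart_tvec A c p v)"
  by (auto simp: chart_tvec_def tv_add_def fun_eq_iff linear_add[OF linear_jacobian])

lemma chart_tvec_scale:
  "c \<in> charts_at A p \<Longrightarrow> chart_tvec A c p (a *\<^sub>R u) = tv_scale a (chart_tvec A c p u)"
  by (auto simp: chart_tvec_def tv_scale_def fun_eq_iff linear_cmul[OF linear_jacobian])

lemma tangent_eqI:
  "c \<in> charts_at A p \<Longrightarrow> v \<in> tangent_space A p \<Longrightarrow> w \<in> tangent_space A p \<Longrightarrow> v c = w c \<Longrightarrow> v = w"
  using chart_tvec_components by metis

lemma tv_add_in_tangent_space:
  "v \<in> tangent_space A p \<Longrightarrow> w \<in> tangent_space A p \<Longrightarrow> tv_add v w \<in> tangent_space A p"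
  by (rule tangent_spaceI)
    (simp_all add: tv_add_def linear_add[OF linear_jacobian] tangent_space_jacobian tangent_space_outside)

lemma tv_scale_in_tangent_space:
  "v \<in> tangent_space A p \<Longrightarrow> tv_scale a v \<in> tangent_space A p"
  by (rule tangent_spaceI)
    (simp_all add: tv_scale_def linear_cmul[OF linear_jacobian] tangent_space_jacobian tangent_space_outside)

section \<open>The metric and the connection in charts\<close>

lemma metric_sym:
  "p \<in> topspace X \<Longrightarrow> u \<in> tangent_space A p \<Longrightarrow> v \<in> tangent_space A p \<Longrightarrow> g p u v = g p v u"
  using metric by (auto simp: riemannian_metric_def)

lemma metric_add_left:
  "p \<in> topspace X \<Longrightarrow> u \<in> tangent_space A p \<Longrightarrow> v \<in> tangent_space A p \<Longrightarrow> w \<in> tangent_space A p \<Longrightarrow>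
    g p (tv_add u v) w = g p u w + g p v w"
  using metric by (auto simp: riemannian_metric_def)

lemma metric_scale_left:
  "p \<in> topspace X \<Longrightarrow> u \<in> tangent_space A p \<Longrightarrow> v \<in> tangent_space A p \<Longrightarrow>
    g p (tv_scale a u) v = a * g p u v"
  using metric by (auto simp: riemannian_metric_def)

lemma metric_pos:
  "p \<in> topspace X \<Longrightarrow> u \<in> tangent_space A p \<Longrightarrow> u \<noteq> tv_zero \<Longrightarrow> g p u u > 0"
  using metric by (auto simp: riemannian_metric_def)

lemma metric_add_right:
  "p \<in> topspace X \<Longrightarrow> u \<in> tangent_space A p \<Longrightarrow> v \<in> tangent_space A p \<Longrightarrow> w \<in> tangent_space A p \<Longrightarrow>
    g p w (tv_add u v) = g p w u + g p w v"
  by (metis metric_add_left metric_sym tv_add_in_tangent_space)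

lemma metric_scale_right:
  "p \<in> topspace X \<Longrightarrow> u \<in> tangent_space A p \<Longrightarrow> v \<in> tangent_space A p \<Longrightarrow>
    g p v (tv_scale a u) = a * g p v u"
  by (metis metric_scale_left metric_sym tv_scale_in_tangent_space)

lemmas metric_simps = metric_add_left metric_scale_left metric_add_right metric_scale_right
  tv_add_in_tangent_space tv_scale_in_tangent_space

lemma metric_in_chart_eq:
  "c \<in> charts_at A p \<Longrightarrow>
    metric_in_chart A g c (snd c p) u v = g p (chart_tvec A c p u) (chart_tvec A c p v)"
  by (simp add: metric_in_chart_def charts_at_def chart_inv_into)

lemma metric_components:
  "c \<in> charts_at A p \<Longrightarrow> u \<in> tangent_space A p \<Longrightarrow> v \<in> tangent_space A p \<Longrightarrow>
    metric_in_chart A g c (snd c p) (u c) (v c) = g p u v"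
  by (simp add: metric_in_chart_eq chart_tvec_components)

lemma bilinear_metric_in_chart:
  "c \<in> charts_at A p \<Longrightarrow> bilinear (metric_in_chart A g c (snd c p))"
  using charts_at_topspace[of c p] unfolding bilinear_def
  by (auto intro!: linearI simp: metric_in_chart_eq chart_tvec_add chart_tvec_scale metric_simps
      chart_tvec_in_tangent_space)

lemma bilinear_connection: "c \<in> charts_at A p \<Longrightarrow> bilinear (\<Gamma> c (snd c p))"
  using connection
  by (auto simp: levi_civita_connection_def affine_connection_def charts_at_def chart_image_def)

text \<open>The transformation law of the connection, solved for the second derivative of the
  transition map. In this form it cancels the second-order term when a covariant derivative changes
  charts.\<close>

lemma hessian_eq:
  assumes "c \<in> charts_at A p" "d \<in> charts_at A p"
  shows "hessian c d (snd c p) u v = jacobian c d (snd c p) (\<Gamma> c (snd c p) u v)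
    - \<Gamma> d (snd d p) (jacobian c d (snd c p) u) (jacobian c d (snd c p) v)"
  using connection assms
  by (auto simp: levi_civita_connection_def affine_connection_def charts_at_def)

text \<open>Smoothness of the metric gives the existence of the derivative, and compatibility of the
  connection with the metric gives its value.\<close>

lemma metric_in_chart_has_derivative:
  assumes "c \<in> charts_at A p"
  shows "((\<lambda>y. metric_in_chart A g c y u v) has_derivative
     (\<lambda>w. metric_in_chart A g c (snd c p) (\<Gamma> c (snd c p) w u) v
        + metric_in_chart A g c (snd c p) u (\<Gamma> c (snd c p) w v))) (at (snd c p))"
proof -
  have x: "snd c p \<in> chart_image c" and c: "c \<in> A"
    using assms by (auto simp: charts_at_def chart_image_def)
  have "smooth_on (chart_image c) (\<lambda>y. metric_in_chart A g c y u v)"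
    using metric c by (auto simp: riemannian_metric_def)
  from smooth_on_differentiable[OF this x]
  have "(\<lambda>y. metric_in_chart A g c y u v) differentiable at (snd c p)"
    by (simp add: at_within_open[OF x open_chart_image[OF c]])
  moreover have "(\<lambda>w. metric_in_chart A g c (snd c p) (\<Gamma> c (snd c p) w u) v
        + metric_in_chart A g c (snd c p) u (\<Gamma> c (snd c p) w v)) =
      frechet_derivative (\<lambda>y. metric_in_chart A g c y u v) (at (snd c p))"
    using connection c x by (auto simp: levi_civita_connection_def)
  ultimately show ?thesis
    by (simp add: frechet_derivative_works)
qed

end

section \<open>Curves, velocity and covariant derivative\<close>

locale curve_on_manifold = riemannian_manifold X A g \<Gamma>
  for X :: "'p topology" and A :: "('p, 'n::finite) chart set"
    and g :: "('p, 'n) metric" and \<Gamma> :: "('p, 'n) connection" +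
  fixes I :: "real set" and \<gamma> :: "real \<Rightarrow> 'p"
  assumes interval: "is_interval I" "interior I \<noteq> {}"
    and curve: "regular_curve X A I \<gamma>"
begin

abbreviation "nabla \<equiv> cov_deriv A \<Gamma> I \<gamma>"
abbreviation "vel \<equiv> velocity A I \<gamma>"
abbreviation "field \<equiv> smooth_field_along A I \<gamma>"
abbreviation "chart_times c \<equiv> {t \<in> I. \<gamma> t \<in> fst c}"

lemma curve_in_topspace: "t \<in> I \<Longrightarrow> \<gamma> t \<in> topspace X"
  using curve by (auto simp: regular_curve_def continuous_map_def)

lemma chart_exists:
  assumes "t \<in> I"
  obtains c where "c \<in> charts_at A (\<gamma> t)"
proof -
  have "\<gamma> t \<in> \<Union>(fst ` A)"
    using curve_in_topspace[OF assms] manifold by (simp add: smooth_manifold_def)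
  then show thesis
    using that by (force simp: charts_at_def)
qed

text \<open>Nonempty interior gives two distinct points, and a connected set with more than one
  point has no isolated points. Hence derivatives within \<open>I\<close> are unique, also at
  endpoints.\<close>

lemma at_within_interval:
  assumes "t \<in> I"
  shows "at t within I \<noteq> bot"
proof -
  from interval(2) obtain z where z: "z \<in> interior I" by auto
  then obtain e where "e > 0" "cball z e \<subseteq> I"
    by (meson interior_subset mem_interior_cball)
  then have "z - e \<in> I" "z + e \<in> I" "z - e \<noteq> z + e"
    by (auto simp: subset_iff dist_norm)
  then have "t islimpt I"
    using connected_imp_perfect[of I t] assms interval(1) by (metis is_interval_connected singletonD)
  then show ?thesis
    by (simp add: trivial_limit_within)
qed

text \<open>By continuity of the curve, the times spent in both charts form a relatively open subset
  of \<open>I\<close>. Derivatives within this subset and within \<open>I\<close> are therefore the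
  same.\<close>

lemma at_within_chart_times_Int:
  assumes "t \<in> chart_times c" "t \<in> chart_times d" "c \<in> A" "d \<in> A"
  shows "at t within chart_times c \<inter> chart_times d = at t within I"
proof -
  have "openin (top_of_set I) {t \<in> topspace (top_of_set I). \<gamma> t \<in> fst c \<inter> fst d}"
    using curve openin_Int[OF chart_openin[OF assms(3)] chart_openin[OF assms(4)]]
    by (intro openin_continuous_map_preimage) (auto simp: regular_curve_def)
  moreover have "{t \<in> topspace (top_of_set I). \<gamma> t \<in> fst c \<inter> fst d} = chart_times c \<inter> chart_times d"
    by auto
  ultimately obtain U where "open U" "chart_times c \<inter> chart_times d = I \<inter> U"
    by (auto simp: openin_open)
  then show ?thesis
    using assms by (intro at_within_nhd[of t U]) auto
qed

lemma at_within_chart_times: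
  "t \<in> chart_times c \<Longrightarrow> c \<in> A \<Longrightarrow> at t within chart_times c = at t within I"
  using at_within_chart_times_Int[of t c c] by simp

lemma coord_has_vector_derivative:
  assumes t: "t \<in> I" and c: "c \<in> charts_at A (\<gamma> t)"
  shows "((\<lambda>s. snd c (\<gamma> s)) has_vector_derivative vel t c) (at t within chart_times c)"
proof -
  have td: "t \<in> chart_times c" "c \<in> A" using assms by (auto simp: charts_at_def)
  have "(\<lambda>s. snd c (\<gamma> s)) differentiable (at t within chart_times c)"
    using curve td by (intro smooth_on_differentiable) (auto simp: regular_curve_def)
  then show ?thesis
    using c td by (simp add: velocity_def at_within_chart_times vector_derivative_works)
qed

lemma component_has_vector_derivative:
  assumes V: "field V" and t: "t \<in> I" and c: "c \<in> charts_at A (\<gamma> t)"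
  shows "((\<lambda>s. V s c) has_vector_derivative vector_derivative (\<lambda>s. V s c) (at t within I))
    (at t within chart_times c)"
proof -
  have td: "t \<in> chart_times c" "c \<in> A" using assms by (auto simp: charts_at_def)
  have "(\<lambda>s. V s c) differentiable (at t within chart_times c)"
    using V td by (intro smooth_on_differentiable) (auto simp: smooth_field_along_def)
  then show ?thesis
    using c td by (simp add: at_within_chart_times vector_derivative_works)
qed

lemma field_in_tangent_space: "field V \<Longrightarrow> t \<in> I \<Longrightarrow> V t \<in> tangent_space A (\<gamma> t)"
  by (auto simp: smooth_field_along_def)

text \<open>Both derivatives survive restriction to the times common to the two charts, where the
  functions agree and derivatives are unique.\<close>

lemma has_vector_derivative_chart_change:
  assumes t: "t \<in> I" and c: "c \<in> charts_at A (\<gamma> t)" and d: "d \<in> charts_at A (\<gamma> t)"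
    and f: "(f has_vector_derivative f') (at t within chart_times d)"
    and h: "(h has_vector_derivative h') (at t within chart_times c)"
    and eq: "\<And>s. s \<in> chart_times c \<Longrightarrow> \<gamma> s \<in> fst d \<Longrightarrow> f s = h s"
  shows "f' = h'"
proof -
  have td: "t \<in> chart_times c" "t \<in> chart_times d" "c \<in> A" "d \<in> A"
    using assms by (auto simp: charts_at_def)
  have *: "(f has_vector_derivative f') (at t within chart_times c \<inter> chart_times d)"
    "(h has_vector_derivative h') (at t within chart_times c \<inter> chart_times d)"
    using f h by (auto elim: has_vector_derivative_within_subset)
  then have **: "(f has_vector_derivative h') (at t within chart_times c \<inter> chart_times d)"
    by (rule_tac has_vector_derivative_transform[of t _ f h]) (use td eq in auto)
  have "at t within chart_times c \<inter> chart_times d \<noteq> bot"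
    using at_within_interval[OF t] at_within_chart_times_Int td by simp
  then show ?thesis
    using vector_derivative_unique_within * ** by blast
qed

text \<open>The chain rule for the transition map along the curve.\<close>

lemma velocity_in_tangent_space:
  assumes t: "t \<in> I"
  shows "vel t \<in> tangent_space A (\<gamma> t)"
proof -
  have *: "vel t d = jacobian c d (snd c (\<gamma> t)) (vel t c)"
    if c: "c \<in> charts_at A (\<gamma> t)" and d: "d \<in> charts_at A (\<gamma> t)" for c d
  proof (rule has_vector_derivative_chart_change[OF t c d coord_has_vector_derivative[OF t d]])
    show "((\<lambda>s. transition c d (snd c (\<gamma> s))) has_vector_derivative
        jacobian c d (snd c (\<gamma> t)) (vel t c)) (at t within chart_times c)"
      using vector_derivative_diff_chain_within[OF coord_has_vector_derivative[OF t c]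
        has_derivative_at_withinI[OF transition_has_derivative[OF c d]]]
      by (simp add: o_def)
  qed (use charts_atD[OF c] in \<open>auto simp: transition_apply\<close>)
  show ?thesis
    by (intro tangent_spaceI) (erule (1) *[symmetric], simp add: velocity_def)
qed

text \<open>Component derivatives alone do not transform as tangent vectors: differentiating the
  Jacobian along the curve leaves a Hessian term. The transformation law of the connection is what
  absorbs it.\<close>

lemma cov_deriv_in_tangent_space:
  assumes V: "field V" and t: "t \<in> I"
  shows "nabla V t \<in> tangent_space A (\<gamma> t)"
proof -
  have *: "nabla V t d = jacobian c d (snd c (\<gamma> t)) (nabla V t c)"
    if c: "c \<in> charts_at A (\<gamma> t)" and d: "d \<in> charts_at A (\<gamma> t)" for c d
  proof -
    let ?J = "jacobian c d (snd c (\<gamma> t))"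
    let ?V = "\<lambda>c. vector_derivative (\<lambda>s. V s c) (at t within I)"
    let ?D = "chart_times c \<inter> chart_times d"
    have td: "t \<in> ?D" using c d t by (auto simp: charts_at_def)
    have cs: "c \<in> charts_at A (\<gamma> s)" "d \<in> charts_at A (\<gamma> s)" if "s \<in> ?D" for s
      using that c d by (auto simp: charts_at_def)
    have J: "linear ?J" by (rule linear_jacobian[OF c d])
    have vel: "vel t d = ?J (vel t c)" and Vd: "V t d = ?J (V t c)"
      using velocity_in_tangent_space[OF t] field_in_tangent_space[OF V t] c d
      by (simp_all add: tangent_space_jacobian)
    \<comment> \<open>Product rule for the Jacobian applied to the components in \<open>c\<close>;
      this function is the field in the chart \<open>d\<close>, whose derivative is thereby computed
      a second way.\<close>
    have "((\<lambda>s. jacobian c d (snd c (\<gamma> s)) (V s c)) has_vector_derivative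
        hessian c d (snd c (\<gamma> t)) (vel t c) (V t c) + ?J (?V c)) (at t within ?D)"
    proof (rule has_vector_derivative_linear_family[where F = "\<lambda>s. jacobian c d (snd c (\<gamma> s))", OF td])
      \<comment> \<open>Linearity in the direction that is not differentiated is read off from the
        transformation law.\<close>
      show "linear (hessian c d (snd c (\<gamma> t)) (vel t c))"
        using bilinear_connection[OF c] bilinear_connection[OF d] J
        by (auto intro!: linearI simp: hessian_eq[OF c d] bilinear_radd bilinear_rmul
            linear_add linear_cmul algebra_simps)
      show "((\<lambda>s. jacobian c d (snd c (\<gamma> s)) u) has_vector_derivative
          hessian c d (snd c (\<gamma> t)) (vel t c) u) (at t within ?D)" for u
        using vector_derivative_diff_chain_within[OF
            has_vector_derivative_within_subset[OF coord_has_vector_derivative[OF t c]]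
            has_derivative_at_withinI[OF jacobian_has_derivative[OF c d]]]
        by (simp add: o_def)
      show "((\<lambda>s. V s c) has_vector_derivative ?V c) (at t within ?D)"
        by (rule has_vector_derivative_within_subset[OF component_has_vector_derivative[OF V t c]]) auto
    qed (use cs linear_jacobian in auto)
    then have "((\<lambda>s. V s d) has_vector_derivative
        hessian c d (snd c (\<gamma> t)) (vel t c) (V t c) + ?J (?V c)) (at t within ?D)"
      by (rule has_vector_derivative_transform[OF td, rotated])
        (rule tangent_space_jacobian[OF field_in_tangent_space[OF V] cs, symmetric], auto)
    moreover have "((\<lambda>s. V s d) has_vector_derivative ?V d) (at t within ?D)"
      by (rule has_vector_derivative_within_subset[OF component_has_vector_derivative[OF V t d]]) auto
    moreover have "at t within ?D = at t within I"
      using at_within_chart_times_Int[of t c d] td charts_atD[OF c] charts_atD[OF d] by simp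
    ultimately have "?V d = hessian c d (snd c (\<gamma> t)) (vel t c) (V t c) + ?J (?V c)"
      using vector_derivative_unique_within[OF at_within_interval[OF t]] by (simp only:)
    moreover have "nabla V t e = ?V e + \<Gamma> e (snd e (\<gamma> t)) (vel t e) (V t e)"
      if "e \<in> charts_at A (\<gamma> t)" for e
      using that by (simp add: cov_deriv_def)
    \<comment> \<open>Rewriting the Hessian by \<open>hessian_eq\<close> produces the term with
      \<open>\<Gamma> c\<close> and cancels the one with \<open>\<Gamma> d\<close>.\<close>
    ultimately show ?thesis
      using c d by (simp add: hessian_eq[OF c d] linear_add[OF J]) (simp only: vel Vd)
  qed
  show ?thesis
    by (intro tangent_spaceI) (erule (1) *[symmetric], simp add: cov_deriv_def)
qed

section \<open>Product rule for the metric along the curve\<close>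

text \<open>In one chart, metric compatibility turns the derivative of the metric coefficients into
  two connection terms. Added to the component derivatives of the two fields, they form the
  covariant derivatives.\<close>

lemma metric_has_derivative:
  assumes V: "field V" and W: "field W" and t: "t \<in> I"
  shows "((\<lambda>s. g (\<gamma> s) (V s) (W s)) has_real_derivative
    g (\<gamma> t) (nabla V t) (W t) + g (\<gamma> t) (V t) (nabla W t)) (at t within I)"
proof -
  obtain c where c: "c \<in> charts_at A (\<gamma> t)" using chart_exists[OF t] .
  let ?G = "\<lambda>s. metric_in_chart A g c (snd c (\<gamma> s))"
  let ?L = "\<Gamma> c (snd c (\<gamma> t)) (vel t c)"
  let ?d = "\<lambda>V. vector_derivative (\<lambda>s. V s c) (at t within I)"
  have td: "t \<in> chart_times c" "c \<in> A" using c t by (auto simp: charts_at_def)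
  have cs: "c \<in> charts_at A (\<gamma> s)" if "s \<in> chart_times c" for s
    using that c by (auto simp: charts_at_def)
  note G = bilinear_metric_in_chart[OF cs]
  note G_simps = bilinear_ladd[OF bilinear_metric_in_chart[OF c]]
    bilinear_radd[OF bilinear_metric_in_chart[OF c]] bilinear_lmul[OF bilinear_metric_in_chart[OF c]]
    bilinear_rmul[OF bilinear_metric_in_chart[OF c]] bilinear_radd[OF bilinear_connection[OF c]]
    bilinear_rmul[OF bilinear_connection[OF c]]
  have dG: "((\<lambda>s. ?G s u w) has_vector_derivative ?G t (?L u) w + ?G t u (?L w))
      (at t within chart_times c)" for u w
    using vector_derivative_diff_chain_within[OF coord_has_vector_derivative[OF t c]
        has_derivative_at_withinI[OF metric_in_chart_has_derivative[OF c]]]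
    by (simp add: o_def)
  \<comment> \<open>The product rule is used once for each argument: here the first argument is a
    constant vector \<open>u\<close>, and the result serves as the fixed-vector hypothesis when
    \<open>V\<close> is put in its place.\<close>
  have dGW: "((\<lambda>s. ?G s u (W s c)) has_vector_derivative
      (?G t (?L u) (W t c) + ?G t u (?L (W t c))) + ?G t u (?d W)) (at t within chart_times c)" for u
  proof (rule has_vector_derivative_linear_family[where F = "\<lambda>s w. ?G s u w" and
        D = "\<lambda>w. ?G t (?L u) w + ?G t u (?L w)", OF td(1)])
    show "linear (?G s u)" if "s \<in> chart_times c" for s
      using G[OF that] by (simp add: bilinear_def)
    show "linear (\<lambda>w. ?G t (?L u) w + ?G t u (?L w))"
      by (intro linearI) (simp_all add: G_simps algebra_simps)
  qed (use dG component_has_vector_derivative[OF W t c] in auto)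
  have "((\<lambda>s. ?G s (V s c) (W s c)) has_vector_derivative
      ((?G t (?L (V t c)) (W t c) + ?G t (V t c) (?L (W t c))) + ?G t (V t c) (?d W))
        + ?G t (?d V) (W t c)) (at t within chart_times c)"
  proof (rule has_vector_derivative_linear_family[where F = "\<lambda>s u. ?G s u (W s c)" and
        D = "\<lambda>u. (?G t (?L u) (W t c) + ?G t u (?L (W t c))) + ?G t u (?d W)", OF td(1)])
    show "linear (\<lambda>u. ?G s u (W s c))" if "s \<in> chart_times c" for s
      using G[OF that] by (simp add: bilinear_def)
    show "linear (\<lambda>u. (?G t (?L u) (W t c) + ?G t u (?L (W t c))) + ?G t u (?d W))"
      by (intro linearI) (simp_all add: G_simps algebra_simps)
  qed (use dGW component_has_vector_derivative[OF V t c] in auto)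
  moreover have "((?G t (?L (V t c)) (W t c) + ?G t (V t c) (?L (W t c))) + ?G t (V t c) (?d W))
      + ?G t (?d V) (W t c) = ?G t (nabla V t c) (W t c) + ?G t (V t c) (nabla W t c)"
    using c by (simp add: cov_deriv_def G_simps)
  ultimately have "((\<lambda>s. ?G s (V s c) (W s c)) has_vector_derivative
      g (\<gamma> t) (nabla V t) (W t) + g (\<gamma> t) (V t) (nabla W t)) (at t within chart_times c)"
    using c t V W
    by (simp add: metric_components field_in_tangent_space cov_deriv_in_tangent_space)
  then have "((\<lambda>s. g (\<gamma> s) (V s) (W s)) has_vector_derivative
      g (\<gamma> t) (nabla V t) (W t) + g (\<gamma> t) (V t) (nabla W t)) (at t within chart_times c)"
    by (rule has_vector_derivative_transform[OF td(1), rotated])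
      (use cs V W in \<open>simp add: metric_components field_in_tangent_space\<close>)
  then show ?thesis
    using at_within_chart_times[OF td]
    by (simp add: has_real_derivative_iff_has_vector_derivative)
qed

section \<open>Differentiation with respect to arc length\<close>

abbreviation "speed t \<equiv> tv_norm g (\<gamma> t) (vel t)"
abbreviation "D \<equiv> cov_deriv_arclength A g \<Gamma> I \<gamma>"

lemma speed_pos: "t \<in> I \<Longrightarrow> speed t > 0"
  using metric_pos[OF curve_in_topspace velocity_in_tangent_space] curve
  by (simp add: tv_norm_def regular_curve_def)

lemma D_in_tangent_space: "field V \<Longrightarrow> t \<in> I \<Longrightarrow> D V t \<in> tangent_space A (\<gamma> t)"
  by (simp add: cov_deriv_arclength_def tv_scale_in_tangent_space cov_deriv_in_tangent_space)

lemma D_eq_zero_iff: "t \<in> I \<Longrightarrow> D V t = tv_zero \<longleftrightarrow> nabla V t = tv_zero"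
  using speed_pos[of t] by (auto simp: cov_deriv_arclength_def tv_scale_def tv_zero_def fun_eq_iff)

lemma metric_has_derivative_arclength:
  assumes V: "field V" and W: "field W" and t: "t \<in> I"
  shows "((\<lambda>s. g (\<gamma> s) (V s) (W s)) has_real_derivative
    speed t * (g (\<gamma> t) (D V t) (W t) + g (\<gamma> t) (V t) (D W t))) (at t within I)"
  using metric_has_derivative[OF assms] speed_pos[OF t] assms
  by (simp add: cov_deriv_arclength_def metric_simps curve_in_topspace field_in_tangent_space
      cov_deriv_in_tangent_space distrib_left)

text \<open>The derivative of a constant vanishes, and the positive speed can be cancelled. Applied
  to the frame it yields the Frenet equations; applied to the frame and a parallel field it yields
  the relations between their inner products.\<close>

lemma metric_constant_imp:
  assumes V: "field V" and W: "field W" and t: "t \<in> I"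
    and const: "\<And>s. s \<in> I \<Longrightarrow> g (\<gamma> s) (V s) (W s) = k"
  shows "g (\<gamma> t) (D V t) (W t) + g (\<gamma> t) (V t) (D W t) = 0"
proof -
  have "((\<lambda>s. g (\<gamma> s) (V s) (W s)) has_vector_derivative 0) (at t within I)"
    by (rule has_vector_derivative_transform[OF t const has_vector_derivative_const])
  with metric_has_derivative_arclength[OF V W t]
  have "speed t * (g (\<gamma> t) (D V t) (W t) + g (\<gamma> t) (V t) (D W t)) = 0"
    using vector_derivative_unique_within[OF at_within_interval[OF t]]
    by (simp only: has_real_derivative_iff_has_vector_derivative)
  then show ?thesis
    using speed_pos[OF t] by simp
qed

text \<open>On the convex set \<open>I\<close> a function with vanishing derivative is
  constant.\<close>

lemma metric_constantI:
  assumes V: "field V" and W: "field W"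
    and zero: "\<And>t. t \<in> I \<Longrightarrow> g (\<gamma> t) (D V t) (W t) + g (\<gamma> t) (V t) (D W t) = 0"
  obtains k where "\<And>t. t \<in> I \<Longrightarrow> g (\<gamma> t) (V t) (W t) = k"
proof -
  have "\<exists>k. \<forall>t\<in>I. g (\<gamma> t) (V t) (W t) = k"
    using metric_has_derivative_arclength[OF V W] zero interval(1)
    by (intro has_field_derivative_zero_constant) (auto simp: is_interval_convex)
  then show thesis using that by blast
qed

section \<open>Linear combinations of fields with constant coefficients\<close>

abbreviation lincomb ::
  "real \<Rightarrow> (real \<Rightarrow> ('p, 'n) tvec) \<Rightarrow> real \<Rightarrow> (real \<Rightarrow> ('p, 'n) tvec) \<Rightarrow> real \<Rightarrow> ('p, 'n) tvec" where
  "lincomb a V b W t \<equiv> tv_add (tv_scale a (V t)) (tv_scale b (W t))"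

lemma smooth_field_lincomb:
  assumes V: "field V" and W: "field W"
  shows "field (lincomb a V b W)"
proof -
  have "smooth_on (chart_times c) (\<lambda>t. a *\<^sub>R V t c + b *\<^sub>R W t c)" if c: "c \<in> A" for c
  proof -
    have "at t within chart_times c \<noteq> bot" if "t \<in> chart_times c" for t
      using at_within_chart_times[OF that c] at_within_interval that by simp
    moreover have "Ck_on k (chart_times c) (\<lambda>t. V t c)" "Ck_on k (chart_times c) (\<lambda>t. W t c)" for k
      using V W c by (simp_all add: smooth_on_def smooth_field_along_def)
    ultimately show ?thesis
      unfolding smooth_on_def by (intro allI Ck_on_linear_combination) blast+
  qed
  then show ?thesis
    using V W
    by (simp add: smooth_field_along_def tv_add_in_tangent_space tv_scale_in_tangent_space)
      (simp add: tv_add_def tv_scale_def)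
qed

lemma D_lincomb:
  assumes V: "field V" and W: "field W" and t: "t \<in> I"
  shows "D (lincomb a V b W) t = lincomb a (D V) b (D W) t"
proof -
  have "nabla (lincomb a V b W) t c = a *\<^sub>R nabla V t c + b *\<^sub>R nabla W t c"
    if c: "c \<in> charts_at A (\<gamma> t)" for c
  proof -
    have td: "t \<in> chart_times c" "c \<in> A" using c t by (auto simp: charts_at_def)
    have "((\<lambda>s. a *\<^sub>R V s c + b *\<^sub>R W s c) has_vector_derivative
        a *\<^sub>R vector_derivative (\<lambda>s. V s c) (at t within I)
        + b *\<^sub>R vector_derivative (\<lambda>s. W s c) (at t within I)) (at t within I)"
      using component_has_vector_derivative[OF V t c] component_has_vector_derivative[OF W t c]
      unfolding at_within_chart_times[OF td]
      by (intro has_vector_derivative_add has_vector_derivative_scaleR[OF DERIV_const, simplified])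
    from vector_derivative_within[OF at_within_interval[OF t] this] show ?thesis
      using c bilinear_connection[OF c]
      by (simp add: cov_deriv_def tv_add_def tv_scale_def bilinear_radd bilinear_rmul algebra_simps)
  qed
  then have "nabla (lincomb a V b W) t = lincomb a (nabla V) b (nabla W) t"
    by (auto simp: fun_eq_iff tv_add_def tv_scale_def cov_deriv_def)
  then show ?thesis
    by (simp add: cov_deriv_arclength_def tv_add_def tv_scale_def fun_eq_iff algebra_simps)
qed

end

section \<open>The Frenet frame and its equations\<close>

locale frenet_curve = curve_on_manifold X A g \<Gamma> I \<gamma>
  for X :: "'p topology" and A :: "('p, 3) chart set"
    and g :: "('p, 3) metric" and \<Gamma> :: "('p, 3) connection"
    and I :: "real set" and \<gamma> :: "real \<Rightarrow> 'p" +
  fixes \<omega> :: "('p, 3) chart \<Rightarrow> real \<Rightarrow> real"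
    and T N B :: "real \<Rightarrow> ('p, 3) tvec"
  assumes curvature_pos: "\<And>t. t \<in> I \<Longrightarrow> curvature A g \<Gamma> I \<gamma> t > 0"
    and frame: "frenet_frame A g \<Gamma> I \<gamma> \<omega> T N B"
begin

abbreviation "\<kappa> \<equiv> curvature A g \<Gamma> I \<gamma>"
abbreviation "\<tau> \<equiv> torsion A g \<Gamma> I \<gamma> N B"

lemma frame_fields: "field T" "field N" "field B"
  using frame by (simp_all add: frenet_frame_def)

lemma frame_in_tangent_space:
  "t \<in> I \<Longrightarrow> T t \<in> tangent_space A (\<gamma> t)" "t \<in> I \<Longrightarrow> N t \<in> tangent_space A (\<gamma> t)"
  "t \<in> I \<Longrightarrow> B t \<in> tangent_space A (\<gamma> t)"
  using frame_fields by (simp_all add: field_in_tangent_space)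

lemma T_eq: "t \<in> I \<Longrightarrow> T t = unit_tangent A g I \<gamma> t"
  using frame by (simp add: frenet_frame_def)

text \<open>That \<open>T\<close> has length 1 comes from normalising the velocity. The other
  relations are those of the frame and their mirror images under symmetry of the metric.\<close>

lemma frame_orthonormal:
  assumes t: "t \<in> I"
  shows "g (\<gamma> t) (T t) (T t) = 1" "g (\<gamma> t) (N t) (N t) = 1" "g (\<gamma> t) (B t) (B t) = 1"
    "g (\<gamma> t) (T t) (N t) = 0" "g (\<gamma> t) (T t) (B t) = 0" "g (\<gamma> t) (N t) (B t) = 0"
    "g (\<gamma> t) (N t) (T t) = 0" "g (\<gamma> t) (B t) (T t) = 0" "g (\<gamma> t) (B t) (N t) = 0"
proof -
  have "g (\<gamma> t) (vel t) (vel t) = speed t * speed t"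
    using speed_pos[OF t] by (simp add: tv_norm_def)
  then show "g (\<gamma> t) (T t) (T t) = 1"
    using t speed_pos[OF t]
    by (simp add: T_eq unit_tangent_def metric_simps curve_in_topspace velocity_in_tangent_space)
  show "g (\<gamma> t) (N t) (N t) = 1" "g (\<gamma> t) (B t) (B t) = 1"
    "g (\<gamma> t) (T t) (N t) = 0" "g (\<gamma> t) (T t) (B t) = 0" "g (\<gamma> t) (N t) (B t) = 0"
    using frame t unfolding frenet_frame_def by blast+
  then show "g (\<gamma> t) (N t) (T t) = 0" "g (\<gamma> t) (B t) (T t) = 0" "g (\<gamma> t) (B t) (N t) = 0"
    using metric_sym[OF curve_in_topspace[OF t]] frame_in_tangent_space[OF t] by metis+
qed

text \<open>The determinant in the positivity condition of the frame is nonzero, so the three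
  vectors span. Orthonormality then identifies the coefficients as inner products.\<close>

lemma frame_expansion:
  assumes t: "t \<in> I" and v: "v \<in> tangent_space A (\<gamma> t)"
  shows "v = tv_add (tv_scale (g (\<gamma> t) v (T t)) (T t))
    (tv_add (tv_scale (g (\<gamma> t) v (N t)) (N t)) (tv_scale (g (\<gamma> t) v (B t)) (B t)))"
proof -
  obtain c where c: "c \<in> charts_at A (\<gamma> t)" using chart_exists[OF t] .
  let ?M = "vector [T t c, N t c, B t c] :: real ^ 3 ^ 3"
  have "det ?M \<noteq> 0"
    using frame t c by (force simp: frenet_frame_def)
  \<comment> \<open>The frame vectors are the rows of \<open>?M\<close>; the transpose has them as
    columns and so maps coefficients to linear combinations.\<close>
  then have "invertible (transpose ?M)"
    by (simp add: invertible_det_nz)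
  then obtain M' where "transpose ?M ** M' = mat 1"
    by (auto simp: invertible_def)
  then have "transpose ?M *v (M' *v v c) = v c"
    by (simp add: matrix_vector_mul_assoc)
  then obtain y where "transpose ?M *v y = v c" by blast
  then have "v c = y $ 1 *\<^sub>R T t c + (y $ 2 *\<^sub>R N t c + y $ 3 *\<^sub>R B t c)"
    by (auto simp: matrix_vector_mult_def transpose_def sum_3 vec_eq_iff algebra_simps)
  then have y: "v = tv_add (tv_scale (y $ 1) (T t)) (tv_add (tv_scale (y $ 2) (N t)) (tv_scale (y $ 3) (B t)))"
    using t by (intro tangent_eqI[OF c v])
      (auto simp: tv_add_in_tangent_space tv_scale_in_tangent_space frame_in_tangent_space,
        simp add: tv_add_def tv_scale_def)
  have "g (\<gamma> t) v (T t) = y $ 1" "g (\<gamma> t) v (N t) = y $ 2" "g (\<gamma> t) v (B t) = y $ 3"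
    using t unfolding y
    by (simp_all add: metric_simps curve_in_topspace frame_in_tangent_space frame_orthonormal)
  with y show ?thesis by simp
qed

lemma frenet_T: "t \<in> I \<Longrightarrow> D T t = tv_scale (\<kappa> t) (N t)"
  using frame by (simp add: frenet_frame_def)

lemmas frenet_simps = metric_simps curve_in_topspace frame_in_tangent_space frame_orthonormal frenet_T
  D_in_tangent_space frame_fields

lemma frenet_N:
  assumes t: "t \<in> I"
  shows "D N t = tv_add (tv_scale (- \<kappa> t) (T t)) (tv_scale (\<tau> t) (B t))"
proof -
  have "g (\<gamma> t) (D N t) (T t) = - \<kappa> t"
    using metric_constant_imp[OF frame_fields(2,1) t, of 0] t by (simp add: frenet_simps)
  moreover have "g (\<gamma> t) (D N t) (N t) = 0"
    using metric_constant_imp[OF frame_fields(2,2) t, of 1] t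
      metric_sym[of "\<gamma> t" "D N t" "N t"] by (simp add: frenet_simps)
  ultimately show ?thesis
    using frame_expansion[OF t D_in_tangent_space[OF frame_fields(2) t]]
    by (simp add: torsion_def tv_add_def tv_scale_def)
qed

lemma frenet_B:
  assumes t: "t \<in> I"
  shows "D B t = tv_scale (- \<tau> t) (N t)"
proof -
  have "g (\<gamma> t) (D B t) (T t) = 0"
    using metric_constant_imp[OF frame_fields(3,1) t, of 0] t by (simp add: frenet_simps)
  moreover have "g (\<gamma> t) (D B t) (N t) = - \<tau> t"
    using metric_constant_imp[OF frame_fields(3,2) t, of 0] t by (simp add: frenet_simps frenet_N)
  moreover have "g (\<gamma> t) (D B t) (B t) = 0"
    using metric_constant_imp[OF frame_fields(3,3) t, of 1] t
      metric_sym[of "\<gamma> t" "D B t" "B t"] by (simp add: frenet_simps)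
  ultimately show ?thesis
    using frame_expansion[OF t D_in_tangent_space[OF frame_fields(3) t]]
    by (simp add: tv_add_def tv_scale_def)
qed

section \<open>Constant angle and constant ratio of torsion and curvature\<close>

lemma constant_angle_fieldI:
  assumes r: "\<And>t. t \<in> I \<Longrightarrow> \<tau> t / \<kappa> t = r"
  shows "\<exists>V. constant_angle_field A g \<Gamma> I \<gamma> V"
proof -
  \<comment> \<open>The pair \<open>(a, b)\<close> is \<open>(r, 1)\<close> scaled to unit length,
    that is, cosine and sine of an angle with cotangent \<open>r\<close>.\<close>
  define b where "b = 1 / sqrt (1 + r\<^sup>2)"
  define a where "a = r * b"
  have "1 + r\<^sup>2 > 0" by (simp add: add_pos_nonneg)
  then have ab: "a * a + b * b = 1"
    by (simp add: a_def b_def field_simps power2_eq_square)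
  let ?V = "lincomb a T b B"
  have V: "field ?V"
    by (intro smooth_field_lincomb frame_fields)
  have "D ?V t = tv_zero" if t: "t \<in> I" for t
  proof -
    have "a * \<kappa> t = b * \<tau> t"
      using r[OF t] curvature_pos[OF t] by (auto simp: a_def field_simps)
    then show ?thesis
      unfolding D_lincomb[OF frame_fields(1,3) t] frenet_T[OF t] frenet_B[OF t]
      by (simp add: tv_add_def tv_scale_def tv_zero_def)
  qed
  then have "parallel_along A \<Gamma> I \<gamma> ?V"
    using V by (simp add: parallel_along_def D_eq_zero_iff)
  moreover have n: "tv_norm g (\<gamma> t) (?V t) = 1" if "t \<in> I" for t
    using that ab by (simp add: tv_norm_def frenet_simps)
  \<comment> \<open>As both vectors have length 1, the angle is the \<open>arccos\<close> of their
    inner product, which is the constant \<open>a\<close>.\<close>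
  moreover have "tv_angle g (\<gamma> t) (unit_tangent A g I \<gamma> t) (?V t) = arccos a" if "t \<in> I" for t
    using that n[OF that]
    by (simp add: tv_angle_def frenet_simps flip: T_eq) (simp add: tv_norm_def frenet_simps)
  ultimately show ?thesis
    by (auto simp: constant_angle_field_def)
qed

text \<open>One \<open>\<theta>\<close> serves all times. The clause
  \<open>sin \<theta> \<noteq> 0\<close> ensures that \<open>cot \<theta>\<close> is a genuine
  quotient and not the value 0 that HOL gives to a division by zero.\<close>

lemma constant_angle_fieldD:
  assumes cV: "constant_angle_field A g \<Gamma> I \<gamma> V"
  shows "\<exists>\<theta>. sin \<theta> \<noteq> 0 \<and> (\<forall>t\<in>I. g (\<gamma> t) (T t) (V t) = cos \<theta> \<and> \<tau> t / \<kappa> t = cot \<theta> \<and>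
    V t = tv_add (tv_scale (cos \<theta>) (T t)) (tv_scale (sin \<theta>) (B t)))"
proof -
  obtain \<alpha> where V: "field V" and DV: "\<And>t. t \<in> I \<Longrightarrow> D V t = tv_zero"
    and unit: "\<And>t. t \<in> I \<Longrightarrow> tv_norm g (\<gamma> t) (V t) = 1"
    and angle: "\<And>t. t \<in> I \<Longrightarrow> tv_angle g (\<gamma> t) (unit_tangent A g I \<gamma> t) (V t) = \<alpha>"
    using cV by (auto simp: constant_angle_field_def parallel_along_def D_eq_zero_iff)
  have Vt: "V t \<in> tangent_space A (\<gamma> t)" if "t \<in> I" for t
    using V that by (rule field_in_tangent_space)
  \<comment> \<open>The zero vector is 0 times itself, so homogeneity of the metric makes its inner
    products vanish.\<close>
  have gDV: "g (\<gamma> t) v (D V t) = 0" if "t \<in> I" "v \<in> tangent_space A (\<gamma> t)" for t v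
    using metric_scale_right[OF curve_in_topspace, of t tv_zero v 0] that
      D_in_tangent_space[OF V, of t] DV by (simp add: tv_scale_def tv_zero_def)
  let ?a = "\<lambda>t. g (\<gamma> t) (T t) (V t)" and ?n = "\<lambda>t. g (\<gamma> t) (N t) (V t)"
    and ?b = "\<lambda>t. g (\<gamma> t) (B t) (V t)"
  have expand: "V t = tv_add (tv_scale (?a t) (T t)) (tv_add (tv_scale (?n t) (N t)) (tv_scale (?b t) (B t)))"
    if t: "t \<in> I" for t
    using frame_expansion[OF t Vt[OF t]] metric_sym[OF curve_in_topspace[OF t] Vt[OF t]]
      frame_in_tangent_space[OF t] by simp
  have sq: "?a t * ?a t + ?n t * ?n t + ?b t * ?b t = 1" if t: "t \<in> I" for t
  proof -
    have "g (\<gamma> t) (V t) (V t) = 1"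
      using unit[OF t] by (simp add: tv_norm_def)
    \<comment> \<open>Only the first argument is expanded, against an arbitrary \<open>v\<close>;
      taking \<open>V t\<close> for \<open>v\<close> then gives the sum of squares.\<close>
    moreover have "g (\<gamma> t) (V t) v = ?a t * g (\<gamma> t) (T t) v + ?n t * g (\<gamma> t) (N t) v + ?b t * g (\<gamma> t) (B t) v"
      if v: "v \<in> tangent_space A (\<gamma> t)" for v
      using t v by (subst expand[OF t]) (simp add: frenet_simps)
    ultimately show ?thesis using Vt[OF t] by simp
  qed
  have a: "?a t = cos \<alpha>" if t: "t \<in> I" for t
  proof -
    \<comment> \<open>The cosine undoes \<open>arccos\<close> on the interval from -1 to 1, so the
      inner product must first be bounded; the other two squares in \<open>sq\<close> are
      nonnegative.\<close>
    have "?a t * ?a t \<le> 1"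
      using sq[OF t] zero_le_square[of "?n t"] zero_le_square[of "?b t"] by linarith
    then have "\<bar>?a t\<bar> \<le> 1"
      using abs_square_le_1[of "?a t"] by (simp add: power2_eq_square)
    moreover have "arccos (?a t) = \<alpha>"
      using angle[OF t] unit[OF t] t
      by (simp add: tv_angle_def flip: T_eq) (simp add: tv_norm_def frenet_simps)
    ultimately show ?thesis by (auto simp: cos_arccos_abs)
  qed
  have n: "?n t = 0" if t: "t \<in> I" for t
    using metric_constant_imp[OF frame_fields(1) V t a] t curvature_pos[OF t]
    by (simp add: gDV frenet_simps Vt)
  have "g (\<gamma> t) (D B t) (V t) + g (\<gamma> t) (B t) (D V t) = 0" if "t \<in> I" for t
    using that by (simp add: gDV frenet_simps frenet_B Vt n)
  then obtain k where k: "\<And>t. t \<in> I \<Longrightarrow> ?b t = k"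
    using metric_constantI[OF frame_fields(3) V] by blast
  \<comment> \<open>Relations between the constants \<open>\<alpha>\<close>, \<open>k\<close> and
    \<open>\<theta>\<close> are read off at one time.\<close>
  obtain t0 where t0: "t0 \<in> I"
    using interval(2) interior_subset by blast
  have "(cos \<alpha>)\<^sup>2 + k\<^sup>2 = 1"
    using sq[OF t0] by (simp add: a[OF t0] n[OF t0] k[OF t0] power2_eq_square)
  \<comment> \<open>A new angle is chosen because \<open>k\<close> may be negative, whereas
    \<open>\<alpha>\<close>, a value of \<open>arccos\<close> here, has nonnegative sine.\<close>
  then obtain \<theta> where \<theta>: "cos \<alpha> = cos \<theta>" "k = sin \<theta>"
    using sincos_total_2pi by metis
  have key: "\<kappa> t * cos \<theta> = \<tau> t * sin \<theta>" if t: "t \<in> I" for t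
    using metric_constant_imp[OF frame_fields(2) V t n] t
    by (simp add: gDV frenet_simps frenet_N Vt a k \<theta>)
  \<comment> \<open>If the sine vanished, the cosine would be 1 or -1, and \<open>key\<close> would
    force the curvature to be 0.\<close>
  have s: "sin \<theta> \<noteq> 0"
    using key[OF t0] curvature_pos[OF t0] sin_zero_abs_cos_one[of \<theta>] by auto
  have "\<tau> t / \<kappa> t = cot \<theta>" if t: "t \<in> I" for t
    using key[OF t] curvature_pos[OF t] s by (simp add: cot_def field_simps)
  moreover have "V t = tv_add (tv_scale (cos \<theta>) (T t)) (tv_scale (sin \<theta>) (B t))" if t: "t \<in> I" for t
    using expand[OF t] by (simp add: a[OF t] n[OF t] k[OF t] \<theta> tv_add_def tv_scale_def)
  ultimately show ?thesis
    using s a \<theta> by auto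
qed

end

theorem theorem1:
  fixes X :: "'p topology" and A :: "('p, 3) chart set"
    and g :: "('p, 3) metric" and \<Gamma> :: "('p, 3) connection"
    and I :: "real set" and \<gamma> :: "real \<Rightarrow> 'p"
    and \<omega> :: "('p, 3) chart \<Rightarrow> real \<Rightarrow> real"
    and T N B :: "real \<Rightarrow> ('p, 3) tvec"
    and \<kappa> \<tau> :: "real \<Rightarrow> real"
  assumes manifold: "smooth_manifold X A"
    and metric: "riemannian_metric X A g"
    and connection: "levi_civita_connection A g \<Gamma>"
    and interval: "is_interval I" "interior I \<noteq> {}"
    and curve: "regular_curve X A I \<gamma>"
    and curvature: "\<kappa> = curvature A g \<Gamma> I \<gamma>"
    and curvature_pos: "\<forall>t\<in>I. \<kappa> t > 0"
    and orientation: "orientation_along A I \<gamma> \<omega>"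
    and frame: "frenet_frame A g \<Gamma> I \<gamma> \<omega> T N B"
    and torsion: "\<tau> = torsion A g \<Gamma> I \<gamma> N B"
  shows "((\<exists>V. constant_angle_field A g \<Gamma> I \<gamma> V) \<longleftrightarrow> (\<exists>r. \<forall>t\<in>I. \<tau> t / \<kappa> t = r)) \<and>
    (\<forall>V. constant_angle_field A g \<Gamma> I \<gamma> V \<longrightarrow>
      (\<exists>\<theta>. sin \<theta> \<noteq> 0 \<and>
        (\<forall>t\<in>I. g (\<gamma> t) (T t) (V t) = cos \<theta> \<and>
               \<tau> t / \<kappa> t = cot \<theta> \<and>
               V t = tv_add (tv_scale (cos \<theta>) (T t)) (tv_scale (sin \<theta>) (B t)))))"
proof -
  interpret frenet_curve X A g \<Gamma> I \<gamma> \<omega> T N B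
    using assms by unfold_locales auto
  \<comment> \<open>For a given field the constant ratio is \<open>cot \<theta>\<close>, so
    \<open>constant_angle_fieldD\<close> supplies both the formulas and the forward direction of the
    equivalence.\<close>
  show ?thesis
    unfolding curvature torsion using constant_angle_fieldI constant_angle_fieldD by metis
qed

end
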